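(* For every convex body $K\subset\mathbb{H}^n$, $n\geq 2$, $$\mathrm{diam}\,K=\max\{w_S(K,(z,H_z)) : z\in\partial K\text{ and }H_z\text{ is a supporting hyperplane of }K\text{ at }z\}.$$
   Context: $\mathbb{H}^n$ is $n$-dimensional hyperbolic space with geodesic distance $d$. A convex body is a compact (geodesically) convex set with non-empty interior. A hyperplane $H$ supports $K$ at $z\in\partial K$ if $z\in H$ and $K$ lies in one of the closed half-spaces bounded by $H$. Santaló width: for $z\in\partial K$ and a supporting hyperplane $H_z$ at $z$, let $\ell$ be the line through $z$ orthogonal to $H_z$, let $H'_z$ be the unique supporting hyperplane of $K$ orthogonal to $\ell$ and disjoint from $H_z$, and $\{z'\}=H'_z\cap\ell$; then $w_S(K,(z,H_z))=d(z,z')$. *)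

theory Defs
  imports "HOL-Analysis.Analysis"
begin

text \<open>
  The hyperboloid model of hyperbolic space: for a Euclidean space \<open>'a\<close> of dimension \<open>n\<close>,
  the type \<open>'a hyperbolic\<close> is the upper sheet of the two-sheeted hyperboloid in the Lorentzian
  space \<open>'a \<times> real\<close>, and so is a model of \<open>n\<close>-dimensional hyperbolic space.
\<close>

definition minkowski :: "'a::euclidean_space \<times> real \<Rightarrow> 'a \<times> real \<Rightarrow> real" where
  "minkowski p q = fst p \<bullet> fst q - snd p * snd q"

typedef (overloaded) 'a::euclidean_space hyperbolic =
  "{p :: 'a \<times> real. minkowski p p = - 1 \<and> snd p > 0}"
  morphisms coords Hyp
  by (rule exI[of _ "(0, 1)"]) (simp add: minkowski_def)

lemma minkowski_commute: "minkowski p q = minkowski q p"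
  by (simp add: minkowski_def inner_commute mult.commute)

lemma minkowski_add_left: "minkowski (p + q) r = minkowski p r + minkowski q r"
  and minkowski_add_right: "minkowski r (p + q) = minkowski r p + minkowski r q"
  and minkowski_scaleR_left: "minkowski (c *\<^sub>R p) r = c * minkowski p r"
  and minkowski_scaleR_right: "minkowski r (c *\<^sub>R p) = c * minkowski r p"
  by (simp_all add: minkowski_def algebra_simps inner_add_left inner_add_right)

lemmas minkowski_simps = minkowski_add_left minkowski_add_right
  minkowski_scaleR_left minkowski_scaleR_right

lemma minkowski_coords_self: "minkowski (coords p) (coords p) = - 1"
  and snd_coords_pos: "snd (coords p) > 0"
  using coords[of p] by auto

lemma norm_fst_coords: "(norm (fst (coords p)))\<^sup>2 = (snd (coords p))\<^sup>2 - 1"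
  using minkowski_coords_self[of p] unfolding power2_norm_eq_inner
  by (simp add: minkowski_def power2_eq_square)

lemma norm_fst_coords_less: "norm (fst (coords p)) < snd (coords p)"
proof (rule power2_less_imp_less)
  show "(norm (fst (coords p)))\<^sup>2 < (snd (coords p))\<^sup>2" by (simp add: norm_fst_coords)
  show "0 \<le> snd (coords p)" using snd_coords_pos[of p] by simp
qed

text \<open>Vectors orthogonal to a point of the hyperboloid are spacelike.\<close>

lemma minkowski_tangent_pos:
  assumes "minkowski (coords p) v = 0" "v \<noteq> 0"
  shows "minkowski v v > 0"
proof -
  define y t a b where "y = fst (coords p)" "t = snd (coords p)" "a = fst v" "b = snd v"
  have t: "t > 0" "norm y < t"
    using snd_coords_pos[of p] norm_fst_coords_less[of p] by (simp_all add: y_t_a_b_def)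
  have eq: "y \<bullet> a = t * b" using assms(1) by (simp add: minkowski_def y_t_a_b_def)
  have a0: "a \<noteq> 0"
  proof
    assume "a = 0"
    then have "b = 0" using eq t by simp
    with \<open>a = 0\<close> assms(2) show False by (simp add: y_t_a_b_def prod_eq_iff)
  qed
  have "t * \<bar>b\<bar> = \<bar>y \<bullet> a\<bar>" using eq t by (simp add: abs_mult)
  also have "\<dots> \<le> norm y * norm a" by (rule Cauchy_Schwarz_ineq2)
  also have "\<dots> < t * norm a" using t a0 by simp
  finally have "\<bar>b\<bar> < norm a" using t by simp
  then have "\<bar>b\<bar>\<^sup>2 < (norm a)\<^sup>2" by (intro power_strict_mono) auto
  then show ?thesis unfolding power2_norm_eq_inner
    by (simp add: minkowski_def y_t_a_b_def power2_eq_square)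
qed

lemma minkowski_tangent_Cauchy_Schwarz:
  assumes "minkowski (coords p) v = 0" "minkowski (coords p) w = 0"
  shows "(minkowski v w)\<^sup>2 \<le> minkowski v v * minkowski w w"
proof (cases "w = 0")
  case True
  then show ?thesis by (simp add: minkowski_def)
next
  case False
  have pos: "minkowski w w > 0" using minkowski_tangent_pos[OF assms(2) False] .
  define c where "c = - (minkowski v w / minkowski w w)"
  have "minkowski (v + c *\<^sub>R w) (v + c *\<^sub>R w) \<ge> 0"
  proof (cases "v + c *\<^sub>R w = 0")
    case True then show ?thesis by (simp add: minkowski_def)
  next
    case False
    then show ?thesis using minkowski_tangent_pos[of p "v + c *\<^sub>R w"] assms
      by (simp add: minkowski_simps)
  qed
  moreover have "minkowski (v + c *\<^sub>R w) (v + c *\<^sub>R w)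
      = minkowski v v - (minkowski v w)\<^sup>2 / minkowski w w"
  proof -
    have "minkowski (v + c *\<^sub>R w) (v + c *\<^sub>R w)
        = minkowski v v + 2 * c * minkowski v w + c * c * minkowski w w"
      by (simp add: minkowski_simps minkowski_commute[of w v] algebra_simps)
    then show ?thesis using pos by (simp add: c_def field_simps power2_eq_square)
  qed
  ultimately show ?thesis using pos by (simp add: field_simps)
qed

lemma minkowski_coords_le: "minkowski (coords p) (coords q) \<le> - 1"
proof -
  define a b s t where "a = norm (fst (coords p))" "b = norm (fst (coords q))"
    "s = snd (coords p)" "t = snd (coords q)"
  have *: "s\<^sup>2 = 1 + a\<^sup>2" "t\<^sup>2 = 1 + b\<^sup>2" "s > 0" "t > 0" "a \<ge> 0" "b \<ge> 0"
    using norm_fst_coords[of p] norm_fst_coords[of q] snd_coords_pos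
    by (auto simp: a_b_s_t_def)
  have "(1 + a * b)\<^sup>2 \<le> (s * t)\<^sup>2"
  proof -
    have "(s * t)\<^sup>2 - (1 + a * b)\<^sup>2 = (a - b)\<^sup>2"
      unfolding power_mult_distrib *(1,2) by (simp add: power2_eq_square algebra_simps)
    then show ?thesis using zero_le_power2[of "a - b"] by linarith
  qed
  then have "1 + a * b \<le> s * t"
    by (rule power2_le_imp_le) (use *(3,4) in simp)
  moreover have "fst (coords p) \<bullet> fst (coords q) \<le> a * b"
    by (simp add: a_b_s_t_def norm_cauchy_schwarz)
  ultimately show ?thesis by (simp add: minkowski_def a_b_s_t_def)
qed

lemma minkowski_coords_eq_iff: "minkowski (coords p) (coords q) = - 1 \<longleftrightarrow> p = q"
proof
  assume *: "minkowski (coords p) (coords q) = - 1"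
  define v where "v = coords p + (- 1) *\<^sub>R coords q"
  have "minkowski (coords q) v = 0" "minkowski v v = 0"
    unfolding v_def minkowski_simps minkowski_coords_self
      minkowski_commute[of "coords q" "coords p"] * by simp_all
  then have "v = 0" using minkowski_tangent_pos[of q v] by linarith
  then have "coords p = coords q" by (simp add: v_def)
  then show "p = q" by (simp only: coords_inject)
qed (simp add: minkowski_coords_self)

lemma arcosh_minkowski_triangle:
  "arcosh (- minkowski (coords p) (coords r))
     \<le> arcosh (- minkowski (coords p) (coords q)) + arcosh (- minkowski (coords q) (coords r))"
proof -
  define a b where "a = - minkowski (coords p) (coords q)" "b = - minkowski (coords q) (coords r)"
  have ab: "a \<ge> 1" "b \<ge> 1" using minkowski_coords_le[of p q] minkowski_coords_le[of q r]
    by (simp_all add: a_b_def)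
  define v where "v = coords p + (- a) *\<^sub>R coords q"
  define w where "w = coords r + (- b) *\<^sub>R coords q"
  have v: "minkowski (coords q) v = 0" "minkowski v v = a\<^sup>2 - 1"
    and w: "minkowski (coords q) w = 0" "minkowski w w = b\<^sup>2 - 1"
    and vw: "minkowski v w = minkowski (coords p) (coords r) + a * b"
    by (simp_all add: v_def w_def a_b_def minkowski_simps minkowski_coords_self
      minkowski_commute[of "coords q" "coords p"] minkowski_commute[of "coords r" "coords q"]
      power2_eq_square)
  have "(minkowski v w)\<^sup>2 \<le> (a\<^sup>2 - 1) * (b\<^sup>2 - 1)"
    using minkowski_tangent_Cauchy_Schwarz[OF v(1) w(1)] by (simp add: v w)
  then have "- minkowski v w \<le> sqrt ((a\<^sup>2 - 1) * (b\<^sup>2 - 1))"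
    by (intro real_le_rsqrt) simp
  then have "- minkowski (coords p) (coords r) \<le> a * b + sqrt (a\<^sup>2 - 1) * sqrt (b\<^sup>2 - 1)"
    by (simp add: vw real_sqrt_mult)
  also have "\<dots> = cosh (arcosh a + arcosh b)"
    using ab by (simp add: cosh_add sinh_arcosh_real)
  finally have le: "- minkowski (coords p) (coords r) \<le> cosh (arcosh a + arcosh b)" .
  have c: "- minkowski (coords p) (coords r) \<ge> 1" using minkowski_coords_le[of p r] by simp
  have "arcosh (- minkowski (coords p) (coords r)) \<le> arcosh a + arcosh b"
  proof (rule cosh_real_nonneg_le_iff[THEN iffD1])
    show "cosh (arcosh (- minkowski (coords p) (coords r))) \<le> cosh (arcosh a + arcosh b)"
      using c le by (subst cosh_arcosh_real) simp_all
  qed (use c ab in simp_all)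
  then show ?thesis by (simp add: a_b_def)
qed

text \<open>
  The distance is normalised to curvature \<open>-1\<close>. The topology of \<open>'a hyperbolic\<close>, hence
  \<open>compact\<close>, \<open>interior\<close> and \<open>frontier\<close>, is the one induced by it.
\<close>

instantiation hyperbolic :: (euclidean_space) metric_space
begin

definition dist_hyperbolic :: "'a hyperbolic \<Rightarrow> 'a hyperbolic \<Rightarrow> real" where
  "dist_hyperbolic p q = arcosh (- minkowski (coords p) (coords q))"

definition uniformity_hyperbolic :: "('a hyperbolic \<times> 'a hyperbolic) filter" where
  "uniformity_hyperbolic = (INF e\<in>{0<..}. principal {(x, y). dist x y < e})"

definition open_hyperbolic :: "'a hyperbolic set \<Rightarrow> bool" where
  "open_hyperbolic U \<longleftrightarrow> (\<forall>x\<in>U. \<forall>\<^sub>F (x', y) in uniformity. x' = x \<longrightarrow> y \<in> U)"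

instance
proof
  fix x y z :: "'a hyperbolic"
  show "dist x y = 0 \<longleftrightarrow> x = y"
  proof
    assume "dist x y = 0"
    then have "cosh (arcosh (- minkowski (coords x) (coords y))) = 1"
      by (simp add: dist_hyperbolic_def)
    then have "- minkowski (coords x) (coords y) = 1"
      using minkowski_coords_le[of x y] by (subst (asm) cosh_arcosh_real) simp_all
    then show "x = y" using minkowski_coords_eq_iff[of x y] by linarith
  qed (simp add: dist_hyperbolic_def minkowski_coords_self)
  show "dist x y \<le> dist x z + dist y z"
    using arcosh_minkowski_triangle[of x y z]
    by (simp add: dist_hyperbolic_def minkowski_commute)
qed (simp_all only: uniformity_hyperbolic_def open_hyperbolic_def)

end

text \<open>
  \<open>v\<close> is a unit vector of the tangent space at \<open>p\<close>, which is the Lorentzian orthogonal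
  complement of \<open>p\<close>; the Riemannian metric is the restriction of \<open>minkowski\<close> to it.
\<close>

definition unit_tangent :: "'a::euclidean_space hyperbolic \<Rightarrow> 'a \<times> real \<Rightarrow> bool" where
  "unit_tangent p v \<longleftrightarrow> minkowski (coords p) v = 0 \<and> minkowski v v = 1"

text \<open>
  The unit speed geodesic starting at \<open>p\<close> with velocity \<open>v\<close>; meaningful if \<open>v\<close> is a unit
  tangent vector at \<open>p\<close>, and used only then.
\<close>

definition geodesic ::
    "'a::euclidean_space hyperbolic \<Rightarrow> 'a \<times> real \<Rightarrow> real \<Rightarrow> 'a hyperbolic" where
  "geodesic p v t = Hyp (cosh t *\<^sub>R coords p + sinh t *\<^sub>R v)"

lemma coords_geodesic:
  assumes "unit_tangent p v"
  shows "coords (geodesic p v t) = cosh t *\<^sub>R coords p + sinh t *\<^sub>R v"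
proof -
  define q where "q = cosh t *\<^sub>R coords p + sinh t *\<^sub>R v"
  have pv: "minkowski (coords p) v = 0" "minkowski v (coords p) = 0" "minkowski v v = 1"
    using assms by (simp_all add: unit_tangent_def minkowski_commute)
  have q: "minkowski q q = - 1"
  proof -
    have "minkowski q q = - ((cosh t)\<^sup>2 - (sinh t)\<^sup>2)"
      unfolding q_def minkowski_simps minkowski_coords_self pv
      by (simp add: power2_eq_square)
    then show ?thesis by (simp only: hyperbolic_pythagoras)
  qed
  have "snd q > 0"
  proof -
    define y s a b where "y = fst (coords p)" "s = snd (coords p)" "a = fst v" "b = snd v"
    have s: "s > 0" "norm y < s" "(norm y)\<^sup>2 = s\<^sup>2 - 1"
      using snd_coords_pos[of p] norm_fst_coords_less[of p] norm_fst_coords[of p]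
      by (simp_all add: y_s_a_b_def)
    have a: "(norm a)\<^sup>2 = 1 + b\<^sup>2"
      using pv(3) unfolding power2_norm_eq_inner
      by (simp add: minkowski_def y_s_a_b_def power2_eq_square)
    have eq: "y \<bullet> a = s * b"
      using pv(1) by (simp add: minkowski_def y_s_a_b_def)
    have "(s * b)\<^sup>2 \<le> (norm y)\<^sup>2 * (norm a)\<^sup>2"
      using Cauchy_Schwarz_ineq[of y a] by (simp add: eq power2_norm_eq_inner)
    also have "\<dots> = (s * b)\<^sup>2 + (s\<^sup>2 - 1 - b\<^sup>2)"
      unfolding a s(3) power_mult_distrib by (simp add: algebra_simps)
    finally have "\<bar>b\<bar>\<^sup>2 < s\<^sup>2" unfolding power2_abs by linarith
    then have "\<bar>b\<bar> < s" by (rule power2_less_imp_less) (use s(1) in simp)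
    have "\<bar>sinh t\<bar> \<le> cosh t"
    proof (rule power2_le_imp_le)
      show "\<bar>sinh t\<bar>\<^sup>2 \<le> (cosh t)\<^sup>2" unfolding power2_abs sinh_square_eq by simp
    qed simp
    then have "\<bar>sinh t\<bar> * \<bar>b\<bar> \<le> cosh t * \<bar>b\<bar>" by (rule mult_right_mono) simp
    also have "\<dots> < cosh t * s" using \<open>\<bar>b\<bar> < s\<close> by (rule mult_strict_left_mono) simp
    finally have "\<bar>sinh t * b\<bar> < cosh t * s" by (simp only: abs_mult)
    then have "0 < cosh t * s + sinh t * b" by linarith
    then show ?thesis by (simp add: q_def y_s_a_b_def)
  qed
  with q show ?thesis unfolding geodesic_def q_def[symmetric] by (intro Hyp_inverse) simp
qed

lemma dist_geodesic:
  assumes "unit_tangent p v"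
  shows "dist (geodesic p v s) (geodesic p v t) = \<bar>s - t\<bar>"
proof -
  have "- minkowski (coords (geodesic p v s)) (coords (geodesic p v t)) = cosh \<bar>s - t\<bar>"
  proof -
    have pv: "minkowski (coords p) v = 0" "minkowski v (coords p) = 0" "minkowski v v = 1"
      using assms by (simp_all add: unit_tangent_def minkowski_commute)
    have "- minkowski (coords (geodesic p v s)) (coords (geodesic p v t)) = cosh (s - t)"
      unfolding coords_geodesic[OF assms] minkowski_simps minkowski_coords_self pv cosh_diff
      by simp
    also have "\<dots> = cosh \<bar>s - t\<bar>" by (simp only: cosh_real_abs)
    finally show ?thesis .
  qed
  then show ?thesis by (simp only: dist_hyperbolic_def arcosh_cosh_real abs_ge_zero)
qed

definition geodesic_line :: "'a::euclidean_space hyperbolic \<Rightarrow> 'a \<times> real \<Rightarrow> 'a hyperbolic set" where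
  "geodesic_line p v = range (geodesic p v)"

definition geodesically_convex :: "'a::euclidean_space hyperbolic set \<Rightarrow> bool" where
  "geodesically_convex K \<longleftrightarrow>
     (\<forall>p v T. unit_tangent p v \<and> 0 \<le> T \<and> geodesic p v 0 \<in> K \<and> geodesic p v T \<in> K
        \<longrightarrow> geodesic p v ` {0..T} \<subseteq> K)"

definition convex_body :: "'a::euclidean_space hyperbolic set \<Rightarrow> bool" where
  "convex_body K \<longleftrightarrow> compact K \<and> geodesically_convex K \<and> interior K \<noteq> {}"

text \<open>
  The hyperplanes are the non-empty intersections with linear hyperplanes of \<open>'a \<times> real\<close>,
  that is, with those whose Lorentzian normal \<open>u\<close> is spacelike (\<open>minkowski u u > 0\<close>). The other
  half-space bounded by \<open>hyperplane u\<close> is \<open>half_space (- u)\<close>.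
\<close>

definition hyperplane :: "'a::euclidean_space \<times> real \<Rightarrow> 'a hyperbolic set" where
  "hyperplane u = {x. minkowski (coords x) u = 0}"

definition half_space :: "'a::euclidean_space \<times> real \<Rightarrow> 'a hyperbolic set" where
  "half_space u = {x. minkowski (coords x) u \<le> 0}"

definition supports_at ::
    "'a::euclidean_space hyperbolic set \<Rightarrow> 'a hyperbolic set \<Rightarrow> 'a hyperbolic \<Rightarrow> bool" where
  "supports_at H K z \<longleftrightarrow> z \<in> frontier K \<and> z \<in> H \<and>
     (\<exists>u. minkowski u u > 0 \<and> H = hyperplane u \<and> K \<subseteq> half_space u)"

text \<open>
  A line \<open>l\<close> is orthogonal to a hyperplane \<open>H\<close> if it meets \<open>H\<close> in a point \<open>p\<close> and is
  perpendicular there to every line through \<open>p\<close> contained in \<open>H\<close>.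
\<close>

definition line_orthogonal ::
    "'a::euclidean_space hyperbolic set \<Rightarrow> 'a hyperbolic set \<Rightarrow> bool" where
  "line_orthogonal l H \<longleftrightarrow>
     (\<exists>p v. p \<in> H \<and> unit_tangent p v \<and> l = geodesic_line p v \<and>
        (\<forall>w. unit_tangent p w \<and> geodesic_line p w \<subseteq> H \<longrightarrow> minkowski v w = 0))"

definition normal_line ::
    "'a::euclidean_space hyperbolic \<Rightarrow> 'a hyperbolic set \<Rightarrow> 'a hyperbolic set" where
  "normal_line z H = (THE l. z \<in> l \<and> line_orthogonal l H)"

definition opposite_hyperplane ::
    "'a::euclidean_space hyperbolic set \<Rightarrow> 'a hyperbolic \<Rightarrow> 'a hyperbolic set \<Rightarrow> 'a hyperbolic set"
  where
  "opposite_hyperplane K z H =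
     (THE H'. (\<exists>y. supports_at H' K y) \<and> line_orthogonal (normal_line z H) H' \<and> H' \<inter> H = {})"

definition santalo_width ::
    "'a::euclidean_space hyperbolic set \<Rightarrow> 'a hyperbolic \<Rightarrow> 'a hyperbolic set \<Rightarrow> real" where
  "santalo_width K z H =
     dist z (THE z'. opposite_hyperplane K z H \<inter> normal_line z H = {z'})"

end

theory Submission
  imports Defs
begin

text \<open>
  Let \<open>v\<close> be the unit tangent vector at \<open>z\<close> that is normal to the supporting hyperplane and points
  into \<open>K\<close>. The hyperplanes orthogonal to the line \<open>t \<mapsto> geodesic z v t\<close> are the hyperplanes
  \<open>hyperplane (velocity z v t)\<close>, and the one through a point \<open>x\<close> is determined by the parameter \<open>t\<close>
  of the foot of the perpendicular from \<open>x\<close> to the line, for which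
  \<open>tanh t = \<langle>x, v\<rangle> / (- \<langle>x, z\<rangle>)\<close>; this quotient is called \<open>foot z v x\<close> below. On \<open>K\<close> it is
  non-negative and vanishes at \<open>z\<close>, and it attains a positive maximum \<open>tanh T\<close> at some \<open>y \<in> K\<close>.
  Hence \<open>velocity z v T\<close> is normal to the opposite supporting hyperplane, and the Santalo width is
  \<open>T\<close> (\<open>santalo_width_eq\<close>). Since the foot of a point of the hyperplane through
  \<open>geodesic z v T\<close> is the point of the line at parameter \<open>T\<close>, such a point is at distance at least
  \<open>T\<close> from \<open>z\<close> (\<open>foot_le_dist\<close>), so \<open>T \<le> dist z y \<le> diameter K\<close>.

  Conversely, let \<open>x, y \<in> K\<close> be at distance \<open>D = diameter K\<close>. The ball of radius \<open>D\<close> around \<open>y\<close>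
  contains \<open>K\<close> and lies on one side of the hyperplane through \<open>x\<close> that is orthogonal to the line
  through \<open>x\<close> and \<open>y\<close> (\<open>ball_in_half_space\<close>); the same holds with \<open>x\<close> and \<open>y\<close> exchanged. Therefore
  these two hyperplanes support \<open>K\<close> and the width with respect to the first is \<open>D\<close>.
\<close>

section \<open>Geodesics and their velocities\<close>

lemma cosh_dist_hyperbolic:
  "cosh (dist p q) = - minkowski (coords p) (coords q)"
  using minkowski_coords_le[of p q]
  by (simp add: dist_hyperbolic_def cosh_arcosh_real)

lemma minkowski_minus_right [simp]: "minkowski p (- q) = - minkowski p q"
  and minkowski_minus_left [simp]: "minkowski (- p) q = - minkowski p q"
  by (simp_all add: minkowski_def)

lemma unit_tangent_minkowski:
  assumes "unit_tangent p v"
  shows "minkowski (coords p) v = 0" "minkowski v (coords p) = 0" "minkowski v v = 1"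
  using assms by (simp_all add: unit_tangent_def minkowski_commute)

lemma unit_tangent_minus: "unit_tangent p v \<Longrightarrow> unit_tangent p (- v)"
  by (simp add: unit_tangent_def)

lemma geodesic_0 [simp]: "geodesic p v 0 = p"
  by (simp add: geodesic_def coords_inverse)

lemma geodesic_minus: "geodesic p (- v) t = geodesic p v (- t)"
  by (simp add: geodesic_def)

lemma geodesic_line_minus: "geodesic_line p (- v) = geodesic_line p v"
proof -
  have "geodesic p v t \<in> range (geodesic p (- v))"
    and "geodesic p (- v) t \<in> range (geodesic p v)" for t
    using geodesic_minus[of p v "- t"] geodesic_minus[of p v t] by (metis minus_minus rangeI)+
  then show ?thesis unfolding geodesic_line_def by blast
qed

text \<open>The derivative of \<open>geodesic p v\<close> at the parameter \<open>t\<close>.\<close>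

definition velocity :: "'a::euclidean_space hyperbolic \<Rightarrow> 'a \<times> real \<Rightarrow> real \<Rightarrow> 'a \<times> real" where
  "velocity p v t = sinh t *\<^sub>R coords p + cosh t *\<^sub>R v"

lemma velocity_0 [simp]: "velocity p v 0 = v"
  by (simp add: velocity_def)

lemma minkowski_geodesic_velocity:
  assumes "unit_tangent p v"
  shows "minkowski (coords (geodesic p v s)) (velocity p v t) = sinh (s - t)"
  unfolding coords_geodesic[OF assms] velocity_def minkowski_simps minkowski_coords_self
    unit_tangent_minkowski[OF assms] sinh_diff by simp

lemma unit_tangent_velocity:
  assumes "unit_tangent p v"
  shows "unit_tangent (geodesic p v t) (velocity p v t)"
proof -
  have "minkowski (velocity p v t) (velocity p v t) = (cosh t)\<^sup>2 - (sinh t)\<^sup>2"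
    unfolding velocity_def minkowski_simps minkowski_coords_self unit_tangent_minkowski[OF assms]
    by (simp add: power2_eq_square)
  then show ?thesis
    using minkowski_geodesic_velocity[OF assms, of t t]
    by (simp add: unit_tangent_def hyperbolic_pythagoras)
qed

lemma geodesic_geodesic:
  assumes "unit_tangent p v"
  shows "geodesic (geodesic p v t) (velocity p v t) s = geodesic p v (t + s)"
proof -
  have "coords (geodesic (geodesic p v t) (velocity p v t) s) = coords (geodesic p v (t + s))"
    unfolding coords_geodesic[OF unit_tangent_velocity[OF assms]] coords_geodesic[OF assms]
    unfolding velocity_def cosh_add sinh_add
    by (simp add: algebra_simps)
  then show ?thesis by (simp only: coords_inject)
qed

lemma geodesic_line_velocity:
  assumes "unit_tangent p v"
  shows "geodesic_line (geodesic p v t) (velocity p v t) = geodesic_line p v"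
proof -
  have "range (\<lambda>s. geodesic p v (t + s)) = geodesic p v ` range ((+) t)"
    by (simp only: image_image)
  also have "range ((+) t) = UNIV" by (rule surj_plus)
  finally have "range (\<lambda>s. geodesic p v (t + s)) = range (geodesic p v)" .
  then show ?thesis by (simp add: geodesic_line_def geodesic_geodesic[OF assms])
qed

lemma geodesic_through:
  assumes "x \<noteq> y"
  obtains v where "unit_tangent x v" "geodesic x v (dist x y) = y"
proof
  define D where "D = dist x y"
  define v where "v = (1 / sinh D) *\<^sub>R (coords y + (- cosh D) *\<^sub>R coords x)"
  have s: "sinh D > 0" using assms by (simp add: D_def)
  have m: "minkowski (coords x) (coords y) = - cosh D" "minkowski (coords y) (coords x) = - cosh D"
    using cosh_dist_hyperbolic[of x y] by (simp_all add: D_def minkowski_commute)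
  have "minkowski v v = ((cosh D)\<^sup>2 - 1) / (sinh D)\<^sup>2"
    unfolding v_def minkowski_simps minkowski_coords_self m
    by (simp add: power2_eq_square divide_simps)
  then have v: "minkowski v v = 1" using s by (simp add: sinh_square_eq[symmetric])
  show ut: "unit_tangent x v"
    unfolding unit_tangent_def v
    unfolding v_def minkowski_simps minkowski_coords_self m by simp
  have "coords (geodesic x v D) = coords y"
    using s unfolding coords_geodesic[OF ut] by (simp add: v_def)
  then show "geodesic x v (dist x y) = y" by (simp only: coords_inject D_def)
qed

lemma unit_tangent_exists: "\<exists>v. unit_tangent p v"
proof -
  obtain b :: 'a where b: "b \<in> Basis" using nonempty_Basis by blast
  define m where "m = minkowski (coords p) (b, 0)"
  define w where "w = (b, 0) + m *\<^sub>R coords p"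
  have m': "minkowski (b, 0) (coords p) = m" by (simp add: m_def minkowski_commute)
  have bb: "minkowski (b, 0) (b, 0 :: real) = 1" using b by (simp add: minkowski_def)
  have pw: "minkowski (coords p) w = 0"
    unfolding w_def minkowski_simps minkowski_coords_self by (simp add: m_def)
  have "minkowski w w = 1 + m\<^sup>2"
    unfolding w_def minkowski_simps minkowski_coords_self m' bb
    by (simp add: power2_eq_square flip: m_def)
  then have ww: "minkowski w w > 0" by (simp add: add_pos_nonneg)
  have "unit_tangent p ((1 / sqrt (minkowski w w)) *\<^sub>R w)"
    using pw ww by (simp add: unit_tangent_def minkowski_simps)
  then show ?thesis by blast
qed

section \<open>Hyperplanes and supporting hyperplanes\<close>

lemma hyperplane_minus [simp]: "hyperplane (- u) = hyperplane u"
  by (simp add: hyperplane_def)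

lemma supports_at_unit_normal:
  assumes "supports_at H K z"
  obtains u where "unit_tangent z u" "H = hyperplane u" "K \<subseteq> half_space u"
proof -
  obtain u where u: "minkowski u u > 0" "H = hyperplane u" "K \<subseteq> half_space u" "z \<in> H"
    using assms by (auto simp: supports_at_def)
  define c where "c = 1 / sqrt (minkowski u u)"
  have c: "c > 0" using u by (simp add: c_def)
  have "hyperplane (c *\<^sub>R u) = hyperplane u" "half_space (c *\<^sub>R u) = half_space u"
    using c by (auto simp: hyperplane_def half_space_def minkowski_simps mult_le_0_iff)
  moreover have "unit_tangent z (c *\<^sub>R u)"
    using u by (simp add: unit_tangent_def minkowski_simps c_def hyperplane_def)
  ultimately show ?thesis using that u by metis
qed

lemma interior_geodesic:
  assumes "x \<in> interior K" "unit_tangent x v"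
  obtains t where "t > 0" "geodesic x v t \<in> K"
proof -
  obtain e where e: "e > 0" "ball x e \<subseteq> K" using assms(1) by (auto simp: mem_interior)
  have "dist x (geodesic x v (e / 2)) = e / 2"
    using dist_geodesic[OF assms(2), of 0 "e / 2"] e by simp
  then have "geodesic x v (e / 2) \<in> K" using e by (auto simp: subset_iff)
  with that[of "e / 2"] e show ?thesis by simp
qed

lemma not_interior_of_half_space:
  assumes "unit_tangent x u" "K \<subseteq> half_space u"
  shows "x \<notin> interior K"
proof
  assume "x \<in> interior K"
  then obtain t where t: "t > 0" "geodesic x u t \<in> K" using interior_geodesic assms by blast
  have "minkowski (coords (geodesic x u t)) u = sinh t"
    using minkowski_geodesic_velocity[OF assms(1), of t 0] by simp
  then show False using t assms(2) by (auto simp: half_space_def)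
qed

lemma supports_atI:
  assumes "compact K" "z \<in> K" "unit_tangent z u" "K \<subseteq> half_space u"
  shows "supports_at (hyperplane u) K z"
proof -
  have "z \<in> frontier K"
    using assms not_interior_of_half_space[of z u K] compact_imp_closed[of K]
    by (simp add: frontier_def)
  moreover have "minkowski u u > 0" "z \<in> hyperplane u"
    using unit_tangent_minkowski[OF assms(3)] by (simp_all add: hyperplane_def)
  ultimately show ?thesis using assms(4) unfolding supports_at_def by blast
qed

text \<open>A line orthogonal to a hyperplane has the normal of the hyperplane as its direction.\<close>

lemma line_orthogonal_hyperplane_iff:
  assumes u: "minkowski u u = 1"
  shows "line_orthogonal l (hyperplane u) \<longleftrightarrow>
    (\<exists>p. unit_tangent p u \<and> l = geodesic_line p u)"
proof
  assume "line_orthogonal l (hyperplane u)"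
  then obtain p v where pv: "p \<in> hyperplane u" "unit_tangent p v" "l = geodesic_line p v"
    and orth: "\<And>w. unit_tangent p w \<Longrightarrow> geodesic_line p w \<subseteq> hyperplane u \<Longrightarrow> minkowski v w = 0"
    unfolding line_orthogonal_def by blast
  have pu: "unit_tangent p u" using pv u by (simp add: unit_tangent_def hyperplane_def)
  note v = unit_tangent_minkowski[OF pv(2)]
  define c where "c = minkowski v u"
  \<comment> \<open>\<open>w\<close> is the component of \<open>v\<close> tangent to the hyperplane.\<close>
  define w where "w = v + (- c) *\<^sub>R u"
  have pw: "minkowski (coords p) w = 0" and wu: "minkowski w u = 0"
    unfolding w_def minkowski_simps using v unit_tangent_minkowski[OF pu]
    by (simp_all add: c_def)
  have uw: "minkowski u w = 0" using wu by (simp add: minkowski_commute)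
  have "w = 0"
  proof (rule ccontr)
    assume "w \<noteq> 0"
    then have ww: "minkowski w w > 0" using minkowski_tangent_pos[OF pw] by simp
    define a where "a = 1 / sqrt (minkowski w w)"
    have a: "a > 0" using ww by (simp add: a_def)
    have ut: "unit_tangent p (a *\<^sub>R w)"
      using ww pw by (simp add: unit_tangent_def minkowski_simps a_def)
    have "geodesic_line p (a *\<^sub>R w) \<subseteq> hyperplane u"
      using unit_tangent_minkowski[OF pu] wu
      by (auto simp: geodesic_line_def hyperplane_def coords_geodesic[OF ut] minkowski_simps)
    from orth[OF ut this] have "minkowski v w = 0" using a by (simp add: minkowski_simps)
    moreover have "minkowski w w = minkowski v w + (- c) * minkowski u w"
      by (subst (1) w_def) (simp only: minkowski_simps)
    ultimately show False using uw ww by simp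
  qed
  then have vc: "v = c *\<^sub>R u" by (simp add: w_def)
  then have "c * c = 1" using v(3) u by (simp add: minkowski_simps)
  then have "c = 1 \<or> c = - 1" using square_eq_1_iff by blast
  then have "v = u \<or> v = - u" using vc by auto
  then have "l = geodesic_line p u" using pv(3) geodesic_line_minus[of p u] by metis
  then show "\<exists>p. unit_tangent p u \<and> l = geodesic_line p u" using pu by blast
next
  assume "\<exists>p. unit_tangent p u \<and> l = geodesic_line p u"
  then obtain p where p: "unit_tangent p u" "l = geodesic_line p u" by blast
  have "minkowski u w = 0"
    if w: "unit_tangent p w" "geodesic_line p w \<subseteq> hyperplane u" for w
  proof -
    have "geodesic p w 1 \<in> hyperplane u" using w by (auto simp: geodesic_line_def)
    then show ?thesis
      using unit_tangent_minkowski[OF p(1)] minkowski_commute[of u w]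
      by (simp add: hyperplane_def coords_geodesic[OF w(1)] minkowski_simps)
  qed
  moreover have "p \<in> hyperplane u"
    using unit_tangent_minkowski[OF p(1)] by (simp add: hyperplane_def)
  ultimately show "line_orthogonal l (hyperplane u)"
    unfolding line_orthogonal_def using p by blast
qed

lemma normal_line_hyperplane:
  assumes "unit_tangent z u"
  shows "normal_line z (hyperplane u) = geodesic_line z u"
  unfolding normal_line_def
proof (rule the_equality)
  note u = unit_tangent_minkowski[OF assms]
  have "z \<in> geodesic_line z u"
    unfolding geodesic_line_def by (metis geodesic_0 rangeI)
  then show "z \<in> geodesic_line z u \<and> line_orthogonal (geodesic_line z u) (hyperplane u)"
    using line_orthogonal_hyperplane_iff[OF u(3)] assms by blast
  fix l
  assume l: "z \<in> l \<and> line_orthogonal l (hyperplane u)"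
  then obtain p where p: "unit_tangent p u" "l = geodesic_line p u"
    using line_orthogonal_hyperplane_iff[OF u(3)] by blast
  then obtain t where t: "z = geodesic p u t" using l by (auto simp: geodesic_line_def)
  have "sinh t = 0"
    using minkowski_geodesic_velocity[OF p(1), of t 0] u t by simp
  then have "z = p" using t by simp
  then show "l = geodesic_line z u" using p by simp
qed

text \<open>
  A hyperplane orthogonal to \<open>geodesic_line z v\<close> is normal to the velocity of the line at the
  point where they meet.
\<close>

lemma normal_of_orthogonal_hyperplane:
  assumes "unit_tangent z v" "minkowski u u = 1"
    and "line_orthogonal (geodesic_line z v) (hyperplane u)"
  shows "\<exists>t. u = velocity z v t \<or> u = - velocity z v t"
proof -
  obtain p where p: "unit_tangent p u" "geodesic_line z v = geodesic_line p u"
    using line_orthogonal_hyperplane_iff[OF assms(2)] assms(3) by blast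
  have "geodesic p u 0 \<in> geodesic_line z v" "geodesic p u 1 \<in> geodesic_line z v"
    unfolding p(2) unfolding geodesic_line_def by (rule rangeI)+
  then obtain t s where t: "p = geodesic z v t" and s: "geodesic p u 1 = geodesic z v s"
    by (auto simp: geodesic_line_def)
  have "\<bar>t - s\<bar> = dist p (geodesic p u 1)"
    unfolding s unfolding t by (simp add: dist_geodesic[OF assms(1)])
  also have "\<dots> = 1" using dist_geodesic[OF p(1), of 0 1] by simp
  \<comment> \<open>The two lines are parametrised by arc length, with the same or the opposite orientation.\<close>
  finally have ts: "s = t + 1 \<or> s = t - 1" by linarith
  have "cosh 1 *\<^sub>R coords p + sinh 1 *\<^sub>R u = cosh s *\<^sub>R coords z + sinh s *\<^sub>R v"
    using arg_cong[OF s, of coords]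
    by (simp add: coords_geodesic[OF p(1)] coords_geodesic[OF assms(1)])
  moreover have "coords p = cosh t *\<^sub>R coords z + sinh t *\<^sub>R v"
    unfolding t by (rule coords_geodesic[OF assms(1)])
  ultimately have *: "sinh 1 *\<^sub>R u = (cosh s - cosh 1 * cosh t) *\<^sub>R coords z
      + (sinh s - cosh 1 * sinh t) *\<^sub>R v"
    by (simp add: algebra_simps)
  have sinh1: "sinh (1 :: real) \<noteq> 0" by simp
  show ?thesis
    using ts
  proof
    assume "s = t + 1"
    then have "sinh 1 *\<^sub>R u = sinh 1 *\<^sub>R velocity z v t"
      unfolding * velocity_def by (simp add: cosh_add sinh_add algebra_simps)
    then show ?thesis using sinh1 by auto
  next
    assume "s = t - 1"
    then have "cosh s - cosh 1 * cosh t = - (sinh 1 * sinh t)"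
      and "sinh s - cosh 1 * sinh t = - (sinh 1 * cosh t)"
      by (simp_all add: cosh_diff sinh_diff mult.commute)
    then have "sinh 1 *\<^sub>R u = sinh 1 *\<^sub>R (- velocity z v t)"
      unfolding * velocity_def by (simp add: scaleR_diff_right)
    then show ?thesis using sinh1 by (metis scaleR_cancel_left)
  qed
qed

section \<open>Feet of perpendiculars to a line\<close>

text \<open>
  The foot of the perpendicular from \<open>x\<close> to \<open>geodesic_line z v\<close> is the point \<open>geodesic z v t\<close>
  with \<open>x \<in> hyperplane (velocity z v t)\<close>; the following quotient is \<open>tanh t\<close>. It is easier to
  handle than \<open>t\<close> itself.
\<close>

definition foot :: "'a::euclidean_space hyperbolic \<Rightarrow> 'a \<times> real \<Rightarrow> 'a hyperbolic \<Rightarrow> real" where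
  "foot z v x = minkowski (coords x) v / (- minkowski (coords x) (coords z))"

lemma minkowski_velocity_eq_foot:
  "minkowski (coords x) (velocity z v t) =
    cosh t * (- minkowski (coords x) (coords z)) * (foot z v x - tanh t)"
proof -
  have "minkowski (coords x) (coords z) \<noteq> 0" using minkowski_coords_le[of x z] by linarith
  then show ?thesis
    by (simp add: velocity_def minkowski_simps foot_def tanh_def field_simps)
qed

lemma foot_less_iff: "minkowski (coords x) (velocity z v t) < 0 \<longleftrightarrow> foot z v x < tanh t"
  and foot_eq_iff: "minkowski (coords x) (velocity z v t) = 0 \<longleftrightarrow> foot z v x = tanh t"
proof -
  define c where "c = cosh t * (- minkowski (coords x) (coords z))"
  have "c > 0"
    unfolding c_def using minkowski_coords_le[of x z] by (intro mult_pos_pos) auto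
  then show "minkowski (coords x) (velocity z v t) < 0 \<longleftrightarrow> foot z v x < tanh t"
    and "minkowski (coords x) (velocity z v t) = 0 \<longleftrightarrow> foot z v x = tanh t"
    unfolding minkowski_velocity_eq_foot c_def[symmetric] by (auto simp: mult_less_0_iff)
qed

lemma mem_hyperplane_velocity: "x \<in> hyperplane (velocity z v t) \<longleftrightarrow> foot z v x = tanh t"
  by (simp add: hyperplane_def foot_eq_iff)

lemma mem_half_space_velocity: "x \<in> half_space (velocity z v t) \<longleftrightarrow> foot z v x \<le> tanh t"
  and mem_half_space_minus_velocity: "x \<in> half_space (- velocity z v t) \<longleftrightarrow> tanh t \<le> foot z v x"
  using foot_less_iff[of x z v t] foot_eq_iff[of x z v t] by (auto simp: half_space_def)

lemma tanh_attains:
  fixes m :: real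
  assumes "\<bar>m\<bar> < 1"
  shows "\<exists>t. tanh t = m"
proof
  define q where "q = (1 + m) / (1 - m)"
  have "q > 0" using assms by (simp add: q_def)
  then have "tanh (ln (sqrt q)) = (q - 1) / (q + 1)" by (simp add: tanh_ln_real)
  also have "\<dots> = m" using assms by (simp add: q_def field_simps)
  finally show "tanh (ln (sqrt q)) = m" .
qed

lemma foot_base:
  assumes "unit_tangent z v"
  shows "foot z v z = 0"
  using unit_tangent_minkowski[OF assms] by (simp add: foot_def)

lemma foot_square_le:
  assumes "unit_tangent z v"
  shows "(foot z v x * cosh (dist z x))\<^sup>2 \<le> (cosh (dist z x))\<^sup>2 - 1"
proof -
  define c where "c = cosh (dist z x)"
  have m: "minkowski (coords x) (coords z) = - c" "minkowski (coords z) (coords x) = - c"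
    using cosh_dist_hyperbolic[of z x] by (simp_all add: c_def minkowski_commute)
  have c: "c > 0" by (simp add: c_def)
  define w where "w = coords x + (- c) *\<^sub>R coords z"
  have "minkowski (coords z) w = 0" "minkowski w w = c\<^sup>2 - 1"
    unfolding w_def minkowski_simps minkowski_coords_self m by (simp_all add: power2_eq_square)
  moreover have "minkowski w v = foot z v x * c"
    unfolding w_def minkowski_simps foot_def m using unit_tangent_minkowski[OF assms] c by simp
  ultimately show ?thesis
    using minkowski_tangent_Cauchy_Schwarz[of z w v] unit_tangent_minkowski[OF assms]
    by (simp add: c_def)
qed

lemma foot_less_1:
  assumes "unit_tangent z v"
  shows "foot z v x < 1"
proof -
  define c where "c = cosh (dist z x)"
  have c: "c > 0" by (simp add: c_def)
  have "(foot z v x * c)\<^sup>2 < c\<^sup>2" using foot_square_le[OF assms, of x] by (simp add: c_def)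
  then have "foot z v x * c < c" using c power2_less_imp_less by fastforce
  then show ?thesis using c by simp
qed

text \<open>The orthogonal projection to a line does not increase distances from its points.\<close>

lemma foot_le_dist:
  assumes "unit_tangent z v" "foot z v x = tanh t" "t \<ge> 0"
  shows "t \<le> dist z x"
proof -
  define c where "c = cosh (dist z x)"
  have "(tanh t * c)\<^sup>2 \<le> c\<^sup>2 - 1"
    using foot_square_le[OF assms(1), of x] by (simp add: c_def assms(2))
  then have "(sinh t)\<^sup>2 * c\<^sup>2 \<le> (c\<^sup>2 - 1) * (cosh t)\<^sup>2"
    by (simp add: tanh_def power_mult_distrib power_divide field_simps)
  then have "(cosh t)\<^sup>2 \<le> c\<^sup>2" by (simp add: sinh_square_eq algebra_simps)
  then have "cosh t \<le> cosh (dist z x)"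
    unfolding c_def by (rule power2_le_imp_le) simp
  then show ?thesis using assms(3) by (simp add: cosh_real_nonneg_le_iff)
qed

lemma continuous_on_foot:
  assumes "unit_tangent z v"
  shows "continuous_on S (foot z v)"
proof -
  \<comment> \<open>\<open>v\<close> is a combination of two points of the hyperboloid, and the Minkowski product with such
    a point is a function of the distance.\<close>
  have c: "continuous_on S (\<lambda>x. minkowski (coords x) (coords q))" for q
  proof -
    have "continuous_on S (\<lambda>x. - cosh (dist x q))" by (intro continuous_intros)
    then show ?thesis by (simp add: cosh_dist_hyperbolic)
  qed
  have "minkowski (coords x) v = (minkowski (coords x) (coords (geodesic z v 1))
      - cosh 1 * minkowski (coords x) (coords z)) / sinh 1" for x
    by (simp add: coords_geodesic[OF assms] minkowski_simps)
  then have v: "continuous_on S (\<lambda>x. minkowski (coords x) v)"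
    by (simp only:) (intro continuous_intros c; simp)
  have "minkowski (coords x) (coords z) \<noteq> 0" for x
    using minkowski_coords_le[of x z] by linarith
  then show ?thesis unfolding foot_def by (intro continuous_intros c v) simp
qed

section \<open>The Santalo width\<close>

text \<open>
  In the next lemma the supporting hyperplane at \<open>z\<close> has the inward unit normal \<open>v\<close>, and \<open>tanh T\<close> is the
  maximum of \<open>foot z v\<close> on \<open>K\<close>.
\<close>

lemma santalo_width_eq:
  assumes K: "compact K" "z \<in> K" and v: "unit_tangent z v"
    and nonneg: "\<And>x. x \<in> K \<Longrightarrow> 0 \<le> foot z v x"
    and y: "y \<in> K" "foot z v y = tanh T" and T: "T > 0"
    and le: "\<And>x. x \<in> K \<Longrightarrow> foot z v x \<le> tanh T"
  shows "santalo_width K z (hyperplane v) = T"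
proof -
  let ?H = "hyperplane (velocity z v T)"
  note nl = normal_line_hyperplane[OF v]
  have uT: "minkowski (velocity z v t) (velocity z v t) = 1" for t
    using unit_tangent_velocity[OF v, of t] by (simp add: unit_tangent_def)
  have mem0: "x \<in> hyperplane v \<longleftrightarrow> foot z v x = 0" for x
    using mem_hyperplane_velocity[of x z v 0] by simp
  have opp: "opposite_hyperplane K z (hyperplane v) = ?H"
    unfolding opposite_hyperplane_def nl
  proof (rule the_equality)
    have "unit_tangent y (velocity z v T)"
      using y uT by (simp add: unit_tangent_def foot_eq_iff)
    then have "supports_at ?H K y"
      using K y le by (intro supports_atI) (auto simp: mem_half_space_velocity)
    moreover have "line_orthogonal (geodesic_line z v) ?H"
      unfolding line_orthogonal_hyperplane_iff[OF uT]
      using unit_tangent_velocity[OF v] geodesic_line_velocity[OF v] by metis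
    moreover have "?H \<inter> hyperplane v = {}"
      using T by (auto simp: mem0 mem_hyperplane_velocity)
    ultimately show "(\<exists>y. supports_at ?H K y) \<and> line_orthogonal (geodesic_line z v) ?H
        \<and> ?H \<inter> hyperplane v = {}" by blast
  next
    fix H'
    assume *: "(\<exists>y. supports_at H' K y) \<and> line_orthogonal (geodesic_line z v) H'
        \<and> H' \<inter> hyperplane v = {}"
    then obtain y' where y': "supports_at H' K y'" by blast
    then obtain u where u: "unit_tangent y' u" "H' = hyperplane u" "K \<subseteq> half_space u"
      by (rule supports_at_unit_normal)
    have y'K: "y' \<in> K" "y' \<in> H'"
      using y' K compact_imp_closed[of K] by (auto simp: supports_at_def frontier_def)
    obtain t where t: "u = velocity z v t \<or> u = - velocity z v t"
      using normal_of_orthogonal_hyperplane[OF v] unit_tangent_minkowski[OF u(1)] * u(2) by blast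
    then have H': "H' = hyperplane (velocity z v t)" using u(2) by auto
    then have foot_y': "foot z v y' = tanh t" using y'K by (simp add: mem_hyperplane_velocity)
    show "H' = ?H"
      using t
    proof
      assume "u = velocity z v t"
      then have "foot z v y \<le> tanh t" using u(3) y by (auto simp: mem_half_space_velocity)
      then have "tanh t = tanh T" using le[OF y'K(1)] foot_y' y by simp
      then show ?thesis using H' by (simp add: mem_hyperplane_velocity set_eq_iff)
    next
      \<comment> \<open>In this case \<open>tanh t\<close> is the minimum of \<open>foot z v\<close> on \<open>K\<close>, which is \<open>0\<close>, so \<open>H'\<close> meets the
        hyperplane at \<open>z\<close>.\<close>
      assume "u = - velocity z v t"
      then have "tanh t \<le> foot z v z" using u(3) K by (auto simp: mem_half_space_minus_velocity)
      then have "tanh t = tanh 0" using nonneg[OF y'K(1)] foot_y' foot_base[OF v] by simp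
      then have "z \<in> H' \<inter> hyperplane v"
        using H' foot_base[OF v] by (simp add: mem0 mem_hyperplane_velocity)
      then show ?thesis using * by blast
    qed
  qed
  have "?H \<inter> geodesic_line z v = {geodesic z v T}"
    using minkowski_geodesic_velocity[OF v] by (auto simp: geodesic_line_def hyperplane_def)
  then have "(THE z'. ?H \<inter> geodesic_line z v = {z'}) = geodesic z v T" by simp
  then show ?thesis
    unfolding santalo_width_def opp nl using dist_geodesic[OF v, of 0 T] T by simp
qed

lemma santalo_width_le_dist:
  assumes K: "compact K" "interior K \<noteq> {}" and H: "supports_at H K z"
  shows "\<exists>y\<in>K. z \<in> K \<and> santalo_width K z H \<le> dist z y"
proof -
  obtain u where u: "unit_tangent z u" "H = hyperplane u" "K \<subseteq> half_space u"
    using H by (rule supports_at_unit_normal)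
  define v where "v = - u"
  have v: "unit_tangent z v" "H = hyperplane v" "K \<subseteq> half_space (- v)"
    using u by (simp_all add: v_def unit_tangent_minus)
  have z: "z \<in> K"
    using H K compact_imp_closed[of K] by (auto simp: supports_at_def frontier_def)
  have nonneg: "0 \<le> foot z v x" if "x \<in> K" for x
    using v(3) that mem_half_space_minus_velocity[of x z v 0] by auto
  obtain y where y: "y \<in> K" "\<And>x. x \<in> K \<Longrightarrow> foot z v x \<le> foot z v y"
    using continuous_attains_sup[OF K(1) _ continuous_on_foot[OF v(1)]] z by blast
  obtain p where p: "p \<in> interior K" using K by blast
  \<comment> \<open>\<open>K\<close> has an interior point, so it is not contained in the supporting hyperplane.\<close>
  have "foot z v p \<noteq> 0"
  proof
    assume "foot z v p = 0"
    then have "unit_tangent p (- v)"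
      using foot_eq_iff[of p z v 0] unit_tangent_minkowski[OF v(1)] by (simp add: unit_tangent_def)
    then show False using not_interior_of_half_space v(3) p by blast
  qed
  then have pos: "foot z v y > 0"
    using nonneg[of p] y(2)[of p] p interior_subset[of K] by fastforce
  obtain T where fy: "foot z v y = tanh T"
    using tanh_attains[of "foot z v y"] pos foot_less_1[OF v(1), of y]
    by (metis abs_of_pos)
  then have T: "T > 0" using pos by simp
  have "santalo_width K z H = T"
    unfolding v(2) using santalo_width_eq[OF K(1) z v(1) nonneg y(1) fy T] y(2) fy by simp
  then show ?thesis using foot_le_dist[OF v(1) fy] T y z by auto
qed

text \<open>
  The closed ball of radius \<open>D\<close> around \<open>geodesic x v D\<close> has \<open>x\<close> on its boundary. It lies on one
  side of the hyperplane through \<open>x\<close> that is orthogonal to the radius ending at \<open>x\<close>.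
\<close>

lemma ball_in_half_space:
  assumes "unit_tangent x v" "D > 0" "dist (geodesic x v D) p \<le> D"
  shows "p \<in> half_space (- v)"
proof -
  have "cosh (dist (geodesic x v D) p) \<le> cosh D"
    using assms by (simp add: cosh_real_nonneg_le_iff)
  then have "- (cosh D * minkowski (coords p) (coords x) + sinh D * minkowski (coords p) v) \<le> cosh D"
    by (simp add: cosh_dist_hyperbolic coords_geodesic[OF assms(1)] minkowski_simps
        minkowski_commute[of _ "coords p"])
  moreover have "cosh D * minkowski (coords p) (coords x) \<le> cosh D * (- 1)"
    using minkowski_coords_le by (intro mult_left_mono) auto
  ultimately have "sinh D * minkowski (coords p) v \<ge> 0" by simp
  then show ?thesis using assms(2) by (simp add: half_space_def zero_le_mult_iff)
qed

lemma santalo_width_diametral: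
  assumes K: "compact K" "x \<in> K" "y \<in> K" "x \<noteq> y"
    and le: "\<And>p q. p \<in> K \<Longrightarrow> q \<in> K \<Longrightarrow> dist p q \<le> dist x y"
  shows "\<exists>H. supports_at H K x \<and> santalo_width K x H = dist x y"
proof -
  define D where "D = dist x y"
  have D: "D > 0" using K by (simp add: D_def)
  obtain v where v: "unit_tangent x v" and y: "geodesic x v D = y"
    using geodesic_through[OF K(4)] unfolding D_def by blast
  let ?w = "- velocity x v D"
  have w: "unit_tangent y ?w" and x: "geodesic y ?w D = x"
    using unit_tangent_velocity[OF v, of D] geodesic_geodesic[OF v, of D "- D"]
    by (simp_all add: y unit_tangent_minus geodesic_minus)
  have "p \<in> half_space (- v)" if "p \<in> K" for p
    using ball_in_half_space[OF v D] le[OF K(3) that] y by (simp add: D_def)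
  then have Kv: "K \<subseteq> half_space (- v)" by blast
  then have nonneg: "0 \<le> foot x v p" if "p \<in> K" for p
    using that mem_half_space_minus_velocity[of p x v 0] by auto
  have le_D: "foot x v p \<le> tanh D" if "p \<in> K" for p
    using ball_in_half_space[OF w D] le[OF K(2) that] x
    by (simp add: D_def mem_half_space_velocity)
  have "foot x v y = tanh D"
    using minkowski_geodesic_velocity[OF v, of D D] y by (simp add: foot_eq_iff)
  then have "santalo_width K x (hyperplane v) = D"
    using santalo_width_eq[OF K(1,2) v nonneg K(3) _ D le_D] by blast
  moreover have "supports_at (hyperplane (- v)) K x"
    using K Kv v by (intro supports_atI unit_tangent_minus)
  ultimately show ?thesis by (auto simp: D_def)
qed

theorem lemma6p1:
  fixes K :: "'a::euclidean_space hyperbolic set"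
  assumes "DIM('a) \<ge> 2"
    and "convex_body K"
  shows "diameter K \<in> {santalo_width K z H | z H. z \<in> frontier K \<and> supports_at H K z} \<and>
    (\<forall>w \<in> {santalo_width K z H | z H. z \<in> frontier K \<and> supports_at H K z}. w \<le> diameter K)"
proof -
  have K: "compact K" "interior K \<noteq> {}" using assms(2) by (simp_all add: convex_body_def)
  note bounded = diameter_bounded_bound[OF compact_imp_bounded[OF K(1)]]
  obtain p where p: "p \<in> interior K" using K by blast
  then have "p \<in> K" using interior_subset by blast
  then obtain x y where xy: "x \<in> K" "y \<in> K" "dist x y = diameter K"
    using diameter_compact_attained[OF K(1)] by blast
  obtain v where v: "unit_tangent p v" using unit_tangent_exists by blast
  obtain t where t: "t > 0" "geodesic p v t \<in> K" by (rule interior_geodesic[OF p v])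
  have "0 < dist p (geodesic p v t)" using dist_geodesic[OF v, of 0 t] t by simp
  also have "\<dots> \<le> diameter K" using bounded \<open>p \<in> K\<close> t by blast
  finally have "x \<noteq> y" using xy by auto
  then obtain H where H: "supports_at H K x" "santalo_width K x H = diameter K"
    using santalo_width_diametral[OF K(1) xy(1,2)] bounded xy(3) by metis
  have "x \<in> frontier K" using H by (simp add: supports_at_def)
  moreover have "santalo_width K z H' \<le> diameter K" if "supports_at H' K z" for z H'
    using santalo_width_le_dist[OF K that] bounded by (meson order_trans)
  ultimately show ?thesis using H by (intro conjI ballI CollectI) (metis, blast)
qed

end
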